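(* Let $\phi(x)=\frac12x^TQx-x^Tb$ on $\mathbb{R}^n$, where $b\in\mathbb{R}^n$ and $Q\in\mathbb{R}^{n\times n}$ is symmetric positive definite, and apply the Newton-PCG quNac algorithm (described in the context) to $\phi$ from an initial point $x_0\in\mathbb{R}^n$, a symmetric positive definite initial matrix $H_0$, and an integer $\mathrm{max\_q}\ge1$. Let $k\ge1$ be such that the $k$th major iteration is performed. Then $$H_{k+1}Q\mathcal{S}_i=\mathcal{S}_i\qquad\text{for } i=0,\dots,k .$$
   Context: Newton-PCG quNac algorithm for $\phi$ (so $\nabla\phi(x)=Qx-b$ and $\nabla^2\phi\equiv Q$), with exact arithmetic. Fix a stopping tolerance $\epsilon>0$. Set $k=0$ and $d_0=-H_0\nabla\phi(x_0)$. While $\|\nabla\phi(x_k)\|/\|\nabla\phi(x_0)\|>\epsilon$ or $\|\nabla\phi(x_k)\|>\epsilon$, perform the $k$th major iteration: (1) Line search: determine a step $a_k>0$ satisfying $\phi(x_k+a_kd_k)-\phi(x_k)\le c_1a_k\,d_k^T\nabla\phi(x_k)$ with $c_1=10^{-4}$; the value $a_k=1$ is tested first and is used whenever it satisfies this inequality. Set $x_{k+1}=x_k+a_kd_k$. (If $\nabla\phi(x_{k+1})=0$ the algorithm stops, and the $k$th major iteration is not regarded as performed.) (2) PCG call with preconditioner $H_k$ at the point $x_{k+1}$: set $r_0=\nabla\phi(x_{k+1})$, $z_0=H_kr_0$, $p_0=-z_0$, $y_0=0$, and for $i=0,1,\dots,\mathrm{max\_q}-1$ compute $$c_i=p_i^TQp_i,\quad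 \alpha_i=\frac{r_i^Tz_i}{c_i},\quad y_{i+1}=y_i+\alpha_ip_i,\quad r_{i+1}=r_i+\alpha_iQp_i,$$ $$z_{i+1}=H_kr_{i+1},\quad \beta_i=\frac{r_{i+1}^Tz_{i+1}}{r_i^Tz_i},\quad p_{i+1}=-z_{i+1}+\beta_ip_i,$$ leaving the loop early after index $i$ if $\|r_{i+1}\|/\|r_0\|<\min\{0.01,\|\nabla\phi(x_{k+1})\|^{1/2}\}$. Let $q$ be the number of loop passes performed (so the directions $p_0,\dots,p_{q-1}$ were used). Set $$\mathcal{S}_k=\left[c_0^{-1/2}p_0,\dots,c_{q-1}^{-1/2}p_{q-1}\right]\in\mathbb{R}^{n\times q},\qquad d_{k+1}=y_q .$$ (The quantities $r_i,z_i,p_i,c_i,q$ depend on $k$.) (3) Inverse quNac update: $$H_{k+1}=\Pi_k+(I-\Pi_kQ)\,H_k\,(I-Q\Pi_k),\qquad \Pi_k:=\mathcal{S}_k(\mathcal{S}_k^TQ\mathcal{S}_k)^{-1}\mathcal{S}_k^T,$$ where $I$ is the $n\times n$ identity. Then increase $k$ by one. *)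

theory Defs
  imports Complex_Main "Jordan_Normal_Form.Gauss_Jordan_Elimination"
begin

definition spd :: "nat \<Rightarrow> real mat \<Rightarrow> bool" where
  "spd n A \<longleftrightarrow> A \<in> carrier_mat n n \<and> transpose_mat A = A \<and>
     (\<forall>v\<in>carrier_vec n. v \<noteq> 0\<^sub>v n \<longrightarrow> v \<bullet> (A *\<^sub>v v) > 0)"

definition enorm :: "real vec \<Rightarrow> real" where
  "enorm v = sqrt (v \<bullet> v)"

definition phi :: "real mat \<Rightarrow> real vec \<Rightarrow> real vec \<Rightarrow> real" where
  "phi Q b x = 1 / 2 * (x \<bullet> (Q *\<^sub>v x)) - x \<bullet> b"

definition grad :: "real mat \<Rightarrow> real vec \<Rightarrow> real vec \<Rightarrow> real vec" where
  "grad Q b x = Q *\<^sub>v x - b"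

text \<open>For symmetric \<open>Q\<close>, \<open>grad Q b\<close> is indeed the gradient of \<open>phi Q b\<close>: it represents all
  directional derivatives.\<close>

lemma phi_directional_derivative:
  assumes Q: "Q \<in> carrier_mat n n" and sym: "transpose_mat Q = Q"
    and b: "b \<in> carrier_vec n" and x: "x \<in> carrier_vec n" and v: "v \<in> carrier_vec n"
  shows "((\<lambda>t. phi Q b (x + t \<cdot>\<^sub>v v)) has_real_derivative v \<bullet> grad Q b x) (at 0)"
proof -
  have Qx: "Q *\<^sub>v x \<in> carrier_vec n" and Qv: "Q *\<^sub>v v \<in> carrier_vec n"
    using Q x v by auto
  have xQv: "x \<bullet> (Q *\<^sub>v v) = v \<bullet> (Q *\<^sub>v x)"
    using transpose_vec_mult_scalar[OF Q v x] sym
    by (metis Qx comm_scalar_prod v)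
  have expand: "phi Q b (x + t \<cdot>\<^sub>v v)
      = phi Q b x + t * (v \<bullet> grad Q b x) + t\<^sup>2 * (1 / 2 * (v \<bullet> (Q *\<^sub>v v)))" for t
  proof -
    have tv: "t \<cdot>\<^sub>v v \<in> carrier_vec n" "t \<cdot>\<^sub>v (Q *\<^sub>v v) \<in> carrier_vec n" using v Qv by auto
    have "Q *\<^sub>v (x + t \<cdot>\<^sub>v v) = Q *\<^sub>v x + t \<cdot>\<^sub>v (Q *\<^sub>v v)"
      using mult_add_distrib_mat_vec[OF Q x tv(1)] mult_mat_vec[OF Q v] by simp
    moreover have "(x + t \<cdot>\<^sub>v v) \<bullet> (Q *\<^sub>v x + t \<cdot>\<^sub>v (Q *\<^sub>v v))
        = x \<bullet> (Q *\<^sub>v x) + t * (x \<bullet> (Q *\<^sub>v v)) + (t * (v \<bullet> (Q *\<^sub>v x)) + t * (t * (v \<bullet> (Q *\<^sub>v v))))"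
      using x v Qx Qv tv
      by (simp add: add_scalar_prod_distrib[of _ n] scalar_prod_add_distrib[of _ n] algebra_simps)
    moreover have "(x + t \<cdot>\<^sub>v v) \<bullet> b = x \<bullet> b + t * (v \<bullet> b)"
      using x v b tv by (simp add: add_scalar_prod_distrib[of _ n])
    moreover have gv: "v \<bullet> grad Q b x = v \<bullet> (Q *\<^sub>v x) - v \<bullet> b"
      unfolding grad_def using scalar_prod_minus_distrib[OF v Qx b] by simp
    ultimately show ?thesis
      unfolding phi_def gv xQv by (simp add: power2_eq_square algebra_simps)
  qed
  show ?thesis
    unfolding expand by (auto intro!: derivative_eq_intros)
qed

record pcg_state =
  pcg_y :: "real vec"
  pcg_r :: "real vec"
  pcg_z :: "real vec"
  pcg_p :: "real vec"

text \<open>\<open>pcg Q H g i\<close> holds the iterates \<open>y\<^sub>i, r\<^sub>i, z\<^sub>i, p\<^sub>i\<close> of preconditioned CG with matrix \<open>Q\<close>,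
  preconditioner \<open>H\<close> and \<open>r\<^sub>0 = g\<close>.  The exit test is separate, in \<open>pcg_passes\<close>; the iterates
  beyond the exit index are never used.\<close>

primrec pcg :: "real mat \<Rightarrow> real mat \<Rightarrow> real vec \<Rightarrow> nat \<Rightarrow> pcg_state" where
  "pcg Q H g 0 =
     \<lparr> pcg_y = 0\<^sub>v (dim_vec g), pcg_r = g, pcg_z = H *\<^sub>v g, pcg_p = - (H *\<^sub>v g) \<rparr>"
| "pcg Q H g (Suc i) =
     (let s = pcg Q H g i;
          r = pcg_r s; z = pcg_z s; p = pcg_p s;
          c = p \<bullet> (Q *\<^sub>v p);
          \<alpha> = (r \<bullet> z) / c;
          y' = pcg_y s + \<alpha> \<cdot>\<^sub>v p;
          r' = r + \<alpha> \<cdot>\<^sub>v (Q *\<^sub>v p);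
          z' = H *\<^sub>v r';
          \<beta> = (r' \<bullet> z') / (r \<bullet> z);
          p' = - z' + \<beta> \<cdot>\<^sub>v p
      in \<lparr> pcg_y = y', pcg_r = r', pcg_z = z', pcg_p = p' \<rparr>)"

text \<open>The exit test after loop index \<open>i\<close> concerns \<open>r\<^sub>i\<^sub>+\<^sub>1\<close>, and leaving there means \<open>i + 1\<close> passes.
  Hence the number of passes is the least \<open>q \<ge> 1\<close> that equals \<open>max_q\<close> or whose residual \<open>r\<^sub>q\<close>
  satisfies the test.\<close>

definition pcg_passes :: "real mat \<Rightarrow> real mat \<Rightarrow> real vec \<Rightarrow> nat \<Rightarrow> nat" where
  "pcg_passes Q H g max_q =
     (LEAST q. q \<ge> 1 \<and>
        (q = max_q \<or> enorm (pcg_r (pcg Q H g q)) / enorm g < min (1 / 100) (sqrt (enorm g))))"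

definition pcg_S :: "real mat \<Rightarrow> real mat \<Rightarrow> real vec \<Rightarrow> nat \<Rightarrow> real mat" where
  "pcg_S Q H g max_q =
     mat_of_cols (dim_vec g)
       (map (\<lambda>i. let p = pcg_p (pcg Q H g i) in (1 / sqrt (p \<bullet> (Q *\<^sub>v p))) \<cdot>\<^sub>v p)
            [0..<pcg_passes Q H g max_q])"

definition quNac_Pi :: "real mat \<Rightarrow> real mat \<Rightarrow> real mat" where
  "quNac_Pi Q S = S * the (mat_inverse (transpose_mat S * Q * S)) * transpose_mat S"

definition quNac_update :: "real mat \<Rightarrow> real mat \<Rightarrow> real mat \<Rightarrow> real mat" where
  "quNac_update Q H S =
     (let n = dim_row Q; P = quNac_Pi Q S
      in P + (1\<^sub>m n - P * Q) * H * (1\<^sub>m n - Q * P))"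

definition armijo :: "real mat \<Rightarrow> real vec \<Rightarrow> real vec \<Rightarrow> real vec \<Rightarrow> real \<Rightarrow> bool" where
  "armijo Q b x d a \<longleftrightarrow>
     phi Q b (x + a \<cdot>\<^sub>v d) - phi Q b x \<le> 1 / 10 ^ 4 * a * (d \<bullet> grad Q b x)"

text \<open>The line search only constrains the step \<open>a\<close> when the unit step fails, so the algorithm
  is nondeterministic and one major iteration is a relation between the data before it
  (\<open>x, d, H\<close>), the step \<open>a\<close> and block \<open>S\<close> it produces, and the data after it (\<open>x', d', H'\<close>).
  It requires that the while condition holds at \<open>x\<close> and that the algorithm does not stop at a
  vanishing gradient at \<open>x'\<close>.  If the gradient at \<open>x0\<close> vanishes, the quotient in the while
  condition is \<open>0 / 0 = 0\<close>, so no iteration is performed.\<close>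

definition quNac_iteration ::
  "real mat \<Rightarrow> real vec \<Rightarrow> nat \<Rightarrow> real \<Rightarrow> real vec \<Rightarrow>
   real vec \<Rightarrow> real vec \<Rightarrow> real mat \<Rightarrow> real \<Rightarrow> real mat \<Rightarrow>
   real vec \<Rightarrow> real vec \<Rightarrow> real mat \<Rightarrow> bool" where
  "quNac_iteration Q b max_q \<epsilon> x0 x d H a S x' d' H' \<longleftrightarrow>
     (enorm (grad Q b x) / enorm (grad Q b x0) > \<epsilon> \<or> enorm (grad Q b x) > \<epsilon>) \<and>
     a > 0 \<and> armijo Q b x d a \<and> (armijo Q b x d 1 \<longrightarrow> a = 1) \<and>
     x' = x + a \<cdot>\<^sub>v d \<and>
     grad Q b x' \<noteq> 0\<^sub>v (dim_vec x') \<and>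
     S = pcg_S Q H (grad Q b x') max_q \<and>
     d' = pcg_y (pcg Q H (grad Q b x') (pcg_passes Q H (grad Q b x') max_q)) \<and>
     H' = quNac_update Q H S"

text \<open>\<open>quNac_performed \<dots> x d H a S k\<close>: the sequences record a run of the algorithm in which the
  major iterations \<open>0, \<dots>, k\<close> are all performed.\<close>

definition quNac_performed ::
  "real mat \<Rightarrow> real vec \<Rightarrow> nat \<Rightarrow> real \<Rightarrow> real vec \<Rightarrow> real mat \<Rightarrow>
   (nat \<Rightarrow> real vec) \<Rightarrow> (nat \<Rightarrow> real vec) \<Rightarrow> (nat \<Rightarrow> real mat) \<Rightarrow> (nat \<Rightarrow> real) \<Rightarrow>
   (nat \<Rightarrow> real mat) \<Rightarrow> nat \<Rightarrow> bool" where
  "quNac_performed Q b max_q \<epsilon> x0 H0 x d H a S k \<longleftrightarrow>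
     x 0 = x0 \<and> H 0 = H0 \<and> d 0 = - (H0 *\<^sub>v grad Q b x0) \<and>
     (\<forall>j\<le>k. quNac_iteration Q b max_q \<epsilon> x0 (x j) (d j) (H j) (a j) (S j)
               (x (Suc j)) (d (Suc j)) (H (Suc j)))"

end

theory Submission
  imports Defs
begin

text \<open>If the columns of \<open>S\<close> are \<open>Q\<close>-orthonormal, then \<open>\<Pi> = S S\<^sup>T\<close> and \<open>\<Pi> Q\<close> is the
  \<open>Q\<close>-orthogonal projection onto the range of \<open>S\<close>.  The update therefore makes \<open>H' Q\<close> fix the
  columns of \<open>S\<close>, and it keeps a vector \<open>u\<close> with \<open>H Q u = u\<close> fixed as soon as \<open>u\<close> is
  \<open>Q\<close>-conjugate to these columns (lemmas \<open>update_secant_new\<close> and \<open>update_secant_old\<close>).  What has to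
  be shown is that each block is conjugate to all earlier ones.

  Let \<open>u\<close> be a column of an earlier block, so that \<open>H Q u = u\<close>.  Then \<open>u\<^sup>T Q z = u\<^sup>T Q H r = u\<^sup>T r\<close>:
  for a preconditioned residual \<open>z = H r\<close>, conjugacy to \<open>u\<close> is orthogonality of \<open>r\<close> to \<open>u\<close>.  If
  the starting residual \<open>g\<close> is orthogonal to \<open>u\<close>, induction over the inner loop shows that all
  residuals stay orthogonal and all directions conjugate to \<open>u\<close>
  (lemma \<open>direction_conjugate_to_fixed\<close>).

  It remains to see that the new gradient is orthogonal to all earlier blocks.  The direction \<open>d\<close>
  returned by the previous inner loop leads to the point \<open>x + d\<close>, whose gradient is the last
  residual of that loop.  This residual is orthogonal to the block just computed by the
  standard theory of conjugate gradients, and to the older blocks by the preceding paragraph.  So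
  the argument closes provided that the step length is exactly \<open>1\<close>.  This is so because \<open>d\<close>
  minimises \<open>phi\<close> on the affine space \<open>x + span {p\<^sub>0, \<dots>}\<close>: there \<open>d\<^sup>T Q d = - d\<^sup>T g\<close>, hence
  \<open>phi\<close> decreases by exactly half of \<open>- d\<^sup>T g\<close>, which is at least what the line search asks for, and the
  unit step is the one tested first (lemma \<open>unit_step_accepted\<close>).  The initial direction
  \<open>d\<^sub>0\<close> has no such property, but at that point there is no earlier block to be orthogonal to.

  Along the way all \<open>H\<^sub>k\<close> must be positive definite and all residuals used by an inner loop nonzero,
  so that no division in the loop degenerates (lemmas \<open>update_spd\<close> and
  \<open>residual_nonzero_before_exit\<close>).\<close>

section \<open>Symmetric positive definite matrices\<close>

lemma spd_carrier: "spd n A \<Longrightarrow> A \<in> carrier_mat n n"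
  by (simp add: spd_def)

lemma mult_mat_vec_zero:
  "A \<in> carrier_mat nr nc \<Longrightarrow> (A :: real mat) *\<^sub>v 0\<^sub>v nc = 0\<^sub>v nr"
  by (intro eq_vecI) auto

lemma spd_self_adjoint:
  assumes "spd n A" and v: "v \<in> carrier_vec n" and w: "w \<in> carrier_vec n"
  shows "(A *\<^sub>v v) \<bullet> w = v \<bullet> (A *\<^sub>v w)"
  using transpose_vec_mult_scalar[of A n n w v] assms by (simp add: spd_def)

lemma spd_pos: "spd n A \<Longrightarrow> v \<in> carrier_vec n \<Longrightarrow> v \<noteq> 0\<^sub>v n \<Longrightarrow> v \<bullet> (A *\<^sub>v v) > 0"
  by (simp add: spd_def)

lemma spd_nonneg:
  assumes "spd n A" "v \<in> carrier_vec n"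
  shows "v \<bullet> (A *\<^sub>v v) \<ge> 0"
  using spd_pos[OF assms] spd_carrier[OF assms(1)] assms(2)
  by (cases "v = 0\<^sub>v n") auto

lemma scalar_prod_self_pos:
  fixes v :: "real vec"
  assumes "v \<in> carrier_vec n" "v \<noteq> 0\<^sub>v n"
  shows "v \<bullet> v > 0"
  using conjugate_square_greater_0_vec[OF assms(1)] assms by simp

section \<open>The preconditioned conjugate gradient method\<close>

locale pcg_run =
  fixes n :: nat and Q H :: "real mat" and g :: "real vec"
  assumes Q: "spd n Q" and H: "spd n H" and g [simp]: "g \<in> carrier_vec n"
begin

abbreviation "y i \<equiv> pcg_y (pcg Q H g i)"
abbreviation "r i \<equiv> pcg_r (pcg Q H g i)"
abbreviation "z i \<equiv> pcg_z (pcg Q H g i)"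
abbreviation "p i \<equiv> pcg_p (pcg Q H g i)"
abbreviation "c i \<equiv> p i \<bullet> (Q *\<^sub>v p i)"
abbreviation "\<alpha> i \<equiv> (r i \<bullet> z i) / c i"
abbreviation "\<beta> i \<equiv> (r (Suc i) \<bullet> z (Suc i)) / (r i \<bullet> z i)"

lemma Q_carrier [simp]: "Q \<in> carrier_mat n n" using Q by (rule spd_carrier)

lemma H_carrier [simp]: "H \<in> carrier_mat n n" using H by (rule spd_carrier)

lemma Q_dim [simp]: "dim_row Q = n" "dim_col Q = n" using carrier_matD[OF Q_carrier] by this

lemma H_dim [simp]: "dim_row H = n" "dim_col H = n" using carrier_matD[OF H_carrier] by this

lemma g_dim [simp]: "dim_vec g = n" by (rule carrier_vecD[OF g])

lemma Q_zero [simp]: "Q *\<^sub>v 0\<^sub>v n = 0\<^sub>v n"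
  by (rule mult_mat_vec_zero[OF Q_carrier])

lemma Q_vec [simp]: "v \<in> carrier_vec n \<Longrightarrow> Q *\<^sub>v v \<in> carrier_vec n"
  by (rule mult_mat_vec_carrier[OF Q_carrier])

lemma H_vec [simp]: "v \<in> carrier_vec n \<Longrightarrow> H *\<^sub>v v \<in> carrier_vec n"
  by (rule mult_mat_vec_carrier[OF H_carrier])

lemma y_0: "y 0 = 0\<^sub>v n" and r_0: "r 0 = g" and p_0: "p 0 = - z 0"
  using carrier_vecD[OF g] by simp_all

lemma y_Suc: "y (Suc i) = y i + \<alpha> i \<cdot>\<^sub>v p i"
  and r_Suc: "r (Suc i) = r i + \<alpha> i \<cdot>\<^sub>v (Q *\<^sub>v p i)"
  and p_Suc: "p (Suc i) = - z (Suc i) + \<beta> i \<cdot>\<^sub>v p i"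
  by (simp_all add: Let_def)

lemma z_eq: "z i = H *\<^sub>v r i"
  by (cases i) (simp_all add: Let_def)

declare pcg.simps [simp del]

lemma pcg_carrier:
  "y i \<in> carrier_vec n \<and> r i \<in> carrier_vec n \<and> z i \<in> carrier_vec n \<and> p i \<in> carrier_vec n"
proof (induction i)
  case 0
  show ?case by (simp add: y_0 r_0 p_0 z_eq)
next
  case (Suc i)
  then have "r (Suc i) \<in> carrier_vec n" by (simp add: r_Suc)
  with Suc show ?case by (simp add: y_Suc p_Suc z_eq[of "Suc i"])
qed

lemma y_carrier [simp]: "y i \<in> carrier_vec n"
  and r_carrier [simp]: "r i \<in> carrier_vec n"
  and z_carrier [simp]: "z i \<in> carrier_vec n"
  and p_carrier [simp]: "p i \<in> carrier_vec n"
  using pcg_carrier by auto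

lemma dims [simp]: "dim_vec (y i) = n" "dim_vec (r i) = n" "dim_vec (z i) = n" "dim_vec (p i) = n"
  using y_carrier r_carrier z_carrier p_carrier by (auto simp only: carrier_vec_def mem_Collect_eq)

lemma residual_eq: "r i = g + Q *\<^sub>v y i"
proof (induction i)
  case 0
  show ?case by (simp add: r_0 y_0)
next
  case (Suc i)
  then show ?case
    by (simp add: r_Suc y_Suc mult_add_distrib_mat_vec[OF Q_carrier] mult_mat_vec[OF Q_carrier]
        assoc_add_vec[of _ n])
qed

lemma preconditioned_residual_pos: "r i \<noteq> 0\<^sub>v n \<Longrightarrow> r i \<bullet> z i > 0"
  unfolding z_eq by (rule spd_pos[OF H]) auto

lemma Q_commute: "v \<in> carrier_vec n \<Longrightarrow> w \<in> carrier_vec n \<Longrightarrow> v \<bullet> (Q *\<^sub>v w) = w \<bullet> (Q *\<^sub>v v)"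
  using spd_self_adjoint[OF Q] comm_scalar_prod Q_vec by metis

lemma residual_z_commute: "r i \<bullet> z j = r j \<bullet> z i"
proof -
  have "r i \<bullet> z j = z i \<bullet> r j"
    using spd_self_adjoint[OF H r_carrier r_carrier, of i j] by (simp add: z_eq)
  then show ?thesis by (simp add: comm_scalar_prod[of _ n])
qed

text \<open>The preconditioned residual \<open>z\<^sub>i\<close> lies in the span of \<open>p\<^sub>i\<close> and \<open>p\<^sub>i\<^sub>-\<^sub>1\<close>.\<close>

lemma orth_directions_imp_orth_z:
  assumes v: "v \<in> carrier_vec n" and orth: "\<And>j. j \<le> i \<Longrightarrow> v \<bullet> p j = 0"
  shows "v \<bullet> z i = 0"
proof (cases i)
  case 0
  then show ?thesis using orth[of 0] v carrier_vecD[OF v] by (simp add: p_0)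
next
  case (Suc j)
  have "v \<bullet> p i = - (v \<bullet> z i) + \<beta> j * (v \<bullet> p j)"
    using v carrier_vecD[OF v] by (simp add: Suc p_Suc scalar_prod_add_distrib[of _ n])
  then show ?thesis using orth[of i] orth[of j] Suc by simp
qed

lemma direction_residual:
  assumes "\<And>j. j < i \<Longrightarrow> r i \<bullet> p j = 0"
  shows "r i \<bullet> p i = - (r i \<bullet> z i)"
proof (cases i)
  case 0
  then show ?thesis by (simp add: p_0)
next
  case (Suc j)
  then show ?thesis using assms[of j]
    by (simp add: p_Suc scalar_prod_add_distrib[of _ n])
qed

text \<open>The classical induction for conjugate gradients.  Since \<open>\<alpha>\<^sub>j Q p\<^sub>j = r\<^sub>j\<^sub>+\<^sub>1 - r\<^sub>j\<close>,
  conjugacy of \<open>p\<^sub>i\<^sub>+\<^sub>1\<close> to \<open>p\<^sub>j\<close> reduces to the \<open>H\<close>-orthogonality of residuals, which in turn follows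
  from \<open>r\<^sub>i\<^sub>+\<^sub>1\<close> being orthogonal to all earlier directions.  The choice of \<open>\<alpha>\<^sub>i\<close> and \<open>\<beta>\<^sub>i\<close> settles the
  case \<open>j = i\<close>.  The residual with index \<open>i\<close> itself may vanish: the loop is
  allowed to end with an exact solution.\<close>

lemma orthogonality:
  assumes "\<And>j. j < i \<Longrightarrow> r j \<noteq> 0\<^sub>v n"
  shows "(\<forall>j<i. r i \<bullet> p j = 0) \<and> (\<forall>j<i. p i \<bullet> (Q *\<^sub>v p j) = 0) \<and> (\<forall>j<i. c j > 0)"
  using assms
proof (induction i)
  case 0
  show ?case by simp
next
  case (Suc i)
  then have rp: "r i \<bullet> p j = 0" and pQp: "p i \<bullet> (Q *\<^sub>v p j) = 0" and c_old: "c j > 0"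
    if "j < i" for j using that by auto
  have rz: "r i \<bullet> z i > 0" using Suc.prems preconditioned_residual_pos by simp
  have pr: "r i \<bullet> p i = - (r i \<bullet> z i)" using rp by (rule direction_residual)
  have "p i \<noteq> 0\<^sub>v n" using pr rz by auto
  then have c: "c j > 0" if "j < Suc i" for j
    using that c_old spd_pos[OF Q p_carrier, of i] by (cases "j = i") auto
  have \<alpha>: "\<alpha> j > 0" if "j < Suc i" for j
    using that c[OF that] Suc.prems preconditioned_residual_pos by simp
  have rp': "r (Suc i) \<bullet> p j = 0" if "j < Suc i" for j
  proof -
    have "r (Suc i) \<bullet> p j = r i \<bullet> p j + \<alpha> i * (p i \<bullet> (Q *\<^sub>v p j))"
      by (simp add: r_Suc add_scalar_prod_distrib[of _ n] spd_self_adjoint[OF Q])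
    then show ?thesis using that rp[of j] pQp[of j] pr c[of i] by (cases "j = i") auto
  qed
  have rz': "r (Suc i) \<bullet> z j = 0" if "j < Suc i" for j
    using that rp' by (intro orth_directions_imp_orth_z) auto
  \<comment> \<open>Here \<open>Q p\<^sub>j\<close> is replaced by the difference quotient of residuals.\<close>
  have zQp: "z (Suc i) \<bullet> (Q *\<^sub>v p j) = (r (Suc i) \<bullet> z (Suc j)) / \<alpha> j" if "j < Suc i" for j
  proof -
    have "z (Suc i) \<bullet> r (Suc j) = z (Suc i) \<bullet> r j + \<alpha> j * (z (Suc i) \<bullet> (Q *\<^sub>v p j))"
      by (simp add: r_Suc[of j] scalar_prod_add_distrib[of _ n])
    moreover have "z (Suc i) \<bullet> r l = r (Suc i) \<bullet> z l" for l
      using residual_z_commute[of l "Suc i"] by (simp add: comm_scalar_prod[of _ n])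
    ultimately have "r (Suc i) \<bullet> z (Suc j) = \<alpha> j * (z (Suc i) \<bullet> (Q *\<^sub>v p j))"
      using rz'[OF that] by simp
    then show ?thesis using \<alpha>[OF that] by (metis less_irrefl nonzero_mult_div_cancel_left)
  qed
  have "p (Suc i) \<bullet> (Q *\<^sub>v p j) = 0" if "j < Suc i" for j
  proof -
    have *: "p (Suc i) \<bullet> (Q *\<^sub>v p j)
        = - (z (Suc i) \<bullet> (Q *\<^sub>v p j)) + \<beta> i * (p i \<bullet> (Q *\<^sub>v p j))"
      by (simp add: p_Suc add_scalar_prod_distrib[of _ n])
    show ?thesis
    proof (cases "j = i")
      case True
      then show ?thesis using * zQp[of i] rz c[of i] by simp
    next
      case False
      then have "j < i" using that by simp
      then show ?thesis using * zQp[of j] pQp[of j] rz'[of "Suc j"] by simp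
    qed
  qed
  with rp' c show ?case by auto
qed

text \<open>For \<open>u\<close> fixed by \<open>H Q\<close>, symmetry gives \<open>u\<^sup>T Q z = (H Q u)\<^sup>T r = u\<^sup>T r\<close>, so both
  properties propagate together through the recurrences, whatever the values of \<open>\<alpha>\<close> and \<open>\<beta>\<close>.\<close>

lemma direction_conjugate_to_fixed:
  assumes u: "u \<in> carrier_vec n" and fixed: "H *\<^sub>v (Q *\<^sub>v u) = u" and orth: "u \<bullet> g = 0"
  shows "u \<bullet> r i = 0 \<and> u \<bullet> (Q *\<^sub>v p i) = 0"
proof -
  have uQz: "u \<bullet> (Q *\<^sub>v z j) = u \<bullet> r j" for j
  proof -
    have "u \<bullet> (Q *\<^sub>v z j) = (Q *\<^sub>v u) \<bullet> (H *\<^sub>v r j)"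
      using u by (simp add: spd_self_adjoint[OF Q] z_eq)
    also have "\<dots> = (H *\<^sub>v (Q *\<^sub>v u)) \<bullet> r j"
      using u by (simp add: spd_self_adjoint[OF H, of "Q *\<^sub>v u" "r j"])
    finally show ?thesis by (simp add: fixed)
  qed
  have neg: "Q *\<^sub>v (- z j) = - (Q *\<^sub>v z j)" for j
    by (rule eq_vecI) auto
  show ?thesis
  proof (induction i)
    case 0
    then show ?case using u orth uQz[of 0] carrier_vecD[OF u] by (simp add: r_0 p_0 neg)
  next
    case (Suc i)
    then have "u \<bullet> r (Suc i) = 0"
      using u by (simp add: r_Suc scalar_prod_add_distrib[of _ n])
    with Suc show ?case
      using u uQz[of "Suc i"] carrier_vecD[OF u]
      by (simp add: p_Suc mult_add_distrib_mat_vec[OF Q_carrier] neg mult_mat_vec[OF Q_carrier]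
          scalar_prod_add_distrib[of _ n])
  qed
qed

text \<open>The iterate \<open>y\<^sub>i\<close> lies in the span of \<open>p\<^sub>0, \<dots>, p\<^sub>i\<^sub>-\<^sub>1\<close>.\<close>

lemma orth_directions_imp_orth_y:
  assumes v: "v \<in> carrier_vec n" and orth: "\<And>j. j < i \<Longrightarrow> v \<bullet> p j = 0"
  shows "v \<bullet> y i = 0"
  using orth
proof (induction i)
  case 0
  then show ?case using v by (simp add: y_0)
next
  case (Suc i)
  then show ?case using v by (simp add: y_Suc scalar_prod_add_distrib[of _ n])
qed

text \<open>A vanishing residual passes the exit test, whose threshold is positive for \<open>g \<noteq> 0\<close>, so it
  can only be the last one.\<close>

lemma residual_nonzero_before_exit:
  assumes "g \<noteq> 0\<^sub>v n" and "max_q \<ge> 1" and i: "i < pcg_passes Q H g max_q"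
  shows "r i \<noteq> 0\<^sub>v n"
proof (cases "i = 0")
  case True
  then show ?thesis using assms by (simp add: r_0)
next
  case False
  have "enorm g > 0" using scalar_prod_self_pos[OF g assms(1)] by (simp add: enorm_def)
  moreover have "\<not> (i \<ge> 1 \<and> (i = max_q \<or> enorm (r i) / enorm g < min (1 / 100) (sqrt (enorm g))))"
    using i unfolding pcg_passes_def by (rule not_less_Least)
  ultimately show ?thesis using False by (auto simp: enorm_def)
qed

end

section \<open>The update with a conjugate block\<close>

locale conjugate_block =
  fixes n m :: nat and Q S :: "real mat"
  assumes Q: "spd n Q" and S [simp]: "S \<in> carrier_mat n m"
    and conj: "transpose_mat S * Q * S = 1\<^sub>m m"
begin

lemma Q_carrier [simp]: "Q \<in> carrier_mat n n" using Q by (rule spd_carrier)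

lemma T_carrier [simp]: "transpose_mat S \<in> carrier_mat m n" using S by simp

lemma Pi_eq: "quNac_Pi Q S = S * transpose_mat S"
proof -
  have "the (mat_inverse (1\<^sub>m m)) = (1\<^sub>m m :: real mat)"
  proof (cases "mat_inverse (1\<^sub>m m) :: real mat option")
    case None
    have "(1\<^sub>m m :: real mat) \<in> Units (ring_mat TYPE(real) m undefined)"
      unfolding Units_def by (auto simp: ring_mat_simps intro!: bexI[of _ "1\<^sub>m m"])
    then show ?thesis using mat_inverse(1)[OF one_carrier_mat None, of undefined] by blast
  next
    case (Some B)
    then show ?thesis using mat_inverse(2)[OF one_carrier_mat Some] left_mult_one_mat by (metis option.sel)
  qed
  then show ?thesis
    unfolding quNac_Pi_def conj by (simp add: right_mult_one_mat[OF S])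
qed

lemma Pi_carrier [simp]: "quNac_Pi Q S \<in> carrier_mat n n"
  unfolding Pi_eq by (rule mult_carrier_mat[OF S T_carrier])

lemma Pi_mult_vec: "v \<in> carrier_vec n \<Longrightarrow> quNac_Pi Q S *\<^sub>v v = S *\<^sub>v (transpose_mat S *\<^sub>v v)"
  unfolding Pi_eq by (rule assoc_mult_mat_vec[OF S T_carrier])

lemma Pi_symmetric: "transpose_mat (quNac_Pi Q S) = quNac_Pi Q S"
  unfolding Pi_eq by (simp add: transpose_mult[OF S T_carrier])

lemma Pi_Q_col:
  assumes "u \<in> set (cols S)"
  shows "quNac_Pi Q S *\<^sub>v (Q *\<^sub>v u) = u"
proof -
  obtain j where j: "j < m" "u = col S j"
    using assms S by (metis carrier_matD(2) cols_length cols_nth in_set_conv_nth)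
  have u: "u \<in> carrier_vec n" using j S by auto
  have "transpose_mat S *\<^sub>v (Q *\<^sub>v u) = (transpose_mat S * Q) *\<^sub>v u"
    using assoc_mult_mat_vec[OF T_carrier Q_carrier u] by simp
  also have "\<dots> = col (transpose_mat S * Q * S) j"
    using col_mult2[OF mult_carrier_mat[OF T_carrier Q_carrier] S j(1)] j by simp
  also have "\<dots> = unit_vec m j" using j by (simp add: conj)
  finally have *: "transpose_mat S *\<^sub>v (Q *\<^sub>v u) = unit_vec m j" .
  have "quNac_Pi Q S *\<^sub>v (Q *\<^sub>v u) = S *\<^sub>v unit_vec m j"
    using Pi_mult_vec[OF mult_mat_vec_carrier[OF Q_carrier u]] * by simp
  also have "\<dots> = u" using j carrier_matD[OF S] by (intro eq_vecI) (simp_all add: scalar_prod_right_unit[of j m])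
  finally show ?thesis .
qed

lemma transpose_mult_vec_eq_0:
  assumes "v \<in> carrier_vec n" "\<And>w. w \<in> set (cols S) \<Longrightarrow> w \<bullet> v = 0"
  shows "transpose_mat S *\<^sub>v v = 0\<^sub>v m"
proof (rule eq_vecI)
  fix j assume "j < dim_vec (0\<^sub>v m :: real vec)"
  then have "j < m" by simp
  then have "col S j \<in> set (cols S)"
    using carrier_matD(2)[OF S] by (simp add: cols_def)
  then show "(transpose_mat S *\<^sub>v v) $ j = 0\<^sub>v m $ j"
    using assms(2) \<open>j < m\<close> carrier_matD[OF S] by simp
qed (simp add: carrier_matD[OF S])

lemma update_mult_vec:
  fixes H :: "real mat"
  assumes H: "H \<in> carrier_mat n n" and v: "v \<in> carrier_vec n"
  defines "w \<equiv> v - Q *\<^sub>v (quNac_Pi Q S *\<^sub>v v)"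
  shows "quNac_update Q H S *\<^sub>v v
    = quNac_Pi Q S *\<^sub>v v + (H *\<^sub>v w - quNac_Pi Q S *\<^sub>v (Q *\<^sub>v (H *\<^sub>v w)))"
proof -
  let ?P = "quNac_Pi Q S"
  have PQ: "?P * Q \<in> carrier_mat n n" "Q * ?P \<in> carrier_mat n n"
    by (rule mult_carrier_mat[OF Pi_carrier Q_carrier] mult_carrier_mat[OF Q_carrier Pi_carrier])+
  have I: "1\<^sub>m n - ?P * Q \<in> carrier_mat n n" "1\<^sub>m n - Q * ?P \<in> carrier_mat n n"
    by (rule minus_carrier_mat[OF PQ(1)] minus_carrier_mat[OF PQ(2)])+
  have w_eq: "(1\<^sub>m n - Q * ?P) *\<^sub>v v = w"
    unfolding w_def using v
    by (simp add: minus_mult_distrib_mat_vec[OF one_carrier_mat PQ(2) v]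
        assoc_mult_mat_vec[OF Q_carrier Pi_carrier v])
  have w: "w \<in> carrier_vec n" unfolding w_eq[symmetric] using I v by (metis mult_mat_vec_carrier)
  have Hw: "H *\<^sub>v w \<in> carrier_vec n" using H w by (rule mult_mat_vec_carrier)
  have "((1\<^sub>m n - ?P * Q) * H * (1\<^sub>m n - Q * ?P)) *\<^sub>v v = (1\<^sub>m n - ?P * Q) *\<^sub>v (H *\<^sub>v w)"
    using assoc_mult_mat_vec[OF mult_carrier_mat[OF I(1) H] I(2) v]
      assoc_mult_mat_vec[OF I(1) H w] by (simp add: w_eq)
  also have "\<dots> = H *\<^sub>v w - ?P *\<^sub>v (Q *\<^sub>v (H *\<^sub>v w))"
    using Hw by (simp add: minus_mult_distrib_mat_vec[OF one_carrier_mat PQ(1) Hw]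
        assoc_mult_mat_vec[OF Pi_carrier Q_carrier Hw])
  finally show ?thesis
    using add_mult_distrib_mat_vec[OF Pi_carrier
        mult_carrier_mat[OF mult_carrier_mat[OF I(1) H] I(2)] v]
    unfolding quNac_update_def Let_def using carrier_matD[OF Q_carrier] by simp
qed

lemma update_carrier:
  assumes H: "H \<in> carrier_mat n n"
  shows "quNac_update Q H S \<in> carrier_mat n n"
proof -
  have "(1\<^sub>m n - quNac_Pi Q S * Q) * H * (1\<^sub>m n - Q * quNac_Pi Q S) \<in> carrier_mat n n"
    by (intro mult_carrier_mat[of _ n n] minus_carrier_mat H Q_carrier Pi_carrier)
  then show ?thesis
    unfolding quNac_update_def Let_def using carrier_matD[OF Q_carrier]
    by (simp add: add_carrier_mat)
qed

text \<open>Here \<open>(I - Q \<Pi>) Q u = 0\<close>, so the old matrix \<open>H\<close> is not seen and only \<open>\<Pi> Q u = u\<close> remains.\<close>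

lemma update_secant_new:
  assumes H: "H \<in> carrier_mat n n" and u: "u \<in> set (cols S)"
  shows "quNac_update Q H S *\<^sub>v (Q *\<^sub>v u) = u"
proof -
  have uc: "u \<in> carrier_vec n" using u S cols_dim by blast
  have Qu: "Q *\<^sub>v u \<in> carrier_vec n" using mult_mat_vec_carrier[OF Q_carrier uc] .
  show ?thesis
    unfolding update_mult_vec[OF H Qu] Pi_Q_col[OF u]
    using uc Qu by (simp add: mult_mat_vec_zero[OF H] mult_mat_vec_zero[OF Q_carrier]
        mult_mat_vec_zero[OF Pi_carrier])
qed

text \<open>Here \<open>\<Pi> Q u = 0\<close>, so both projections act trivially and \<open>H Q u = u\<close> survives.\<close>

lemma update_secant_old:
  assumes H: "H \<in> carrier_mat n n" and u: "u \<in> carrier_vec n"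
    and fixed: "H *\<^sub>v (Q *\<^sub>v u) = u"
    and orth: "\<And>w. w \<in> set (cols S) \<Longrightarrow> w \<bullet> (Q *\<^sub>v u) = 0"
  shows "quNac_update Q H S *\<^sub>v (Q *\<^sub>v u) = u"
proof -
  have Qu: "Q *\<^sub>v u \<in> carrier_vec n" using mult_mat_vec_carrier[OF Q_carrier u] .
  have "quNac_Pi Q S *\<^sub>v (Q *\<^sub>v u) = 0\<^sub>v n"
    using transpose_mult_vec_eq_0[OF Qu orth] by (simp add: Pi_mult_vec[OF Qu] mult_mat_vec_zero[OF S])
  then show ?thesis
    unfolding update_mult_vec[OF H Qu] using u Qu fixed
    by (simp add: mult_mat_vec_zero[OF Q_carrier] mult_mat_vec_zero[OF Pi_carrier])
qed

text \<open>The quadratic form of the update is \<open>|S\<^sup>T v|\<^sup>2 + w\<^sup>T H w\<close> with \<open>w = v - Q \<Pi> v\<close>.  If the first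
  term vanishes, then \<open>\<Pi> v = 0\<close> and \<open>w = v\<close>, so the second one is positive.\<close>

lemma update_spd:
  assumes H: "spd n H"
  shows "spd n (quNac_update Q H S)"
proof -
  let ?P = "quNac_Pi Q S"
  let ?L = "1\<^sub>m n - ?P * Q" and ?R = "1\<^sub>m n - Q * ?P"
  note Hc [simp] = spd_carrier[OF H]
  have sym: "transpose_mat Q = Q" "transpose_mat H = H" using Q H by (auto simp: spd_def)
  have L [simp]: "?L \<in> carrier_mat n n" and R [simp]: "?R \<in> carrier_mat n n"
    by (intro minus_carrier_mat mult_carrier_mat[of _ n n] Q_carrier Pi_carrier)+
  have LH: "?L * H \<in> carrier_mat n n" by (rule mult_carrier_mat[OF L Hc])
  have LHR: "?L * H * ?R \<in> carrier_mat n n" by (rule mult_carrier_mat[OF LH R])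
  have tL: "transpose_mat ?L = ?R"
    using transpose_minus[OF one_carrier_mat mult_carrier_mat[OF Pi_carrier Q_carrier]]
      transpose_mult[OF Pi_carrier Q_carrier] by (simp add: sym Pi_symmetric)
  then have tR: "transpose_mat ?R = ?L" by (metis transpose_transpose)
  have "transpose_mat (?L * H * ?R) = ?L * (H * ?R)"
    using transpose_mult[OF LH R] transpose_mult[OF L Hc] by (simp add: tL tR sym)
  also have "\<dots> = ?L * H * ?R" by (rule assoc_mult_mat[OF L Hc R, symmetric])
  finally have symU: "transpose_mat (quNac_update Q H S) = quNac_update Q H S"
    unfolding quNac_update_def Let_def
    using transpose_add[OF Pi_carrier LHR] carrier_matD[OF Q_carrier]
    by (simp add: Pi_symmetric)
  have pos: "v \<bullet> (quNac_update Q H S *\<^sub>v v) > 0" if v: "v \<in> carrier_vec n" and "v \<noteq> 0\<^sub>v n" for v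
  proof -
    define t where "t = transpose_mat S *\<^sub>v v"
    define w where "w = v - Q *\<^sub>v (?P *\<^sub>v v)"
    have t: "t \<in> carrier_vec m" unfolding t_def using mult_mat_vec_carrier[OF T_carrier v] .
    have Pc: "?P *\<^sub>v x \<in> carrier_vec n" if "x \<in> carrier_vec n" for x
      using mult_mat_vec_carrier[OF Pi_carrier that] .
    have Qc: "Q *\<^sub>v x \<in> carrier_vec n" if "x \<in> carrier_vec n" for x
      using mult_mat_vec_carrier[OF Q_carrier that] .
    have w: "w \<in> carrier_vec n" unfolding w_def using v Pc Qc by auto
    have Hw: "H *\<^sub>v w \<in> carrier_vec n" using mult_mat_vec_carrier[OF Hc w] .
    have P_comm: "v \<bullet> (?P *\<^sub>v x) = (?P *\<^sub>v v) \<bullet> x" if "x \<in> carrier_vec n" for x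
      using transpose_vec_mult_scalar[OF Pi_carrier that v] by (simp add: Pi_symmetric)
    have "v \<bullet> (?P *\<^sub>v v) = t \<bullet> t"
      using transpose_vec_mult_scalar[OF S t v] by (simp add: Pi_mult_vec[OF v] t_def)
    moreover have "v \<bullet> (H *\<^sub>v w - ?P *\<^sub>v (Q *\<^sub>v (H *\<^sub>v w))) = w \<bullet> (H *\<^sub>v w)"
    proof -
      have "v \<bullet> (?P *\<^sub>v (Q *\<^sub>v (H *\<^sub>v w))) = (Q *\<^sub>v (?P *\<^sub>v v)) \<bullet> (H *\<^sub>v w)"
        using P_comm[OF Qc[OF Hw]] spd_self_adjoint[OF Q Pc[OF v] Hw] by simp
      then show ?thesis unfolding w_def[symmetric]
        using v Hw Pc Qc
        by (simp add: scalar_prod_minus_distrib[of _ n] minus_scalar_prod_distrib[of _ n] w_def)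
    qed
    ultimately have eq: "v \<bullet> (quNac_update Q H S *\<^sub>v v) = t \<bullet> t + w \<bullet> (H *\<^sub>v w)"
      unfolding update_mult_vec[OF Hc v] w_def[symmetric] using v Hw Pc Qc
      by (simp add: scalar_prod_add_distrib[of _ n])
    show ?thesis
    proof (cases "t = 0\<^sub>v m")
      case True
      then have "?P *\<^sub>v v = 0\<^sub>v n" by (simp add: Pi_mult_vec[OF v] t_def mult_mat_vec_zero[OF S])
      then have "w = v" unfolding w_def using v by (simp add: mult_mat_vec_zero[OF Q_carrier])
      then show ?thesis using eq True spd_pos[OF H v] that by simp
    next
      case False
      then show ?thesis using eq scalar_prod_self_pos[OF t] spd_nonneg[OF H w] by simp
    qed
  qed
  show ?thesis
    unfolding spd_def using update_carrier[OF Hc] symU pos by blast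
qed

end

section \<open>One major iteration\<close>

context pcg_run
begin

lemma pcg_S_conjugate_block:
  assumes "\<And>i. i < pcg_passes Q H g max_q \<Longrightarrow> r i \<noteq> 0\<^sub>v n"
  shows "conjugate_block n (pcg_passes Q H g max_q) Q (pcg_S Q H g max_q)"
proof -
  define m where "m = pcg_passes Q H g max_q"
  define s where "s i = (1 / sqrt (c i)) \<cdot>\<^sub>v p i" for i
  let ?S = "pcg_S Q H g max_q"
  have s [simp]: "s i \<in> carrier_vec n" for i by (simp add: s_def)
  have S_eq: "?S = mat_of_cols n (map s [0..<m])"
    by (simp add: pcg_S_def m_def s_def[abs_def] Let_def)
  have S: "?S \<in> carrier_mat n m" using mat_of_cols_carrier(1)[of n "map s [0..<m]"] by (simp add: S_eq)
  have col: "col ?S i = s i" if "i < m" for i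
    using that by (simp add: S_eq)
  have c: "c i > 0" if "i < m" for i
    using orthogonality[of "Suc i"] assms that m_def by auto
  have pQp: "p i \<bullet> (Q *\<^sub>v p j) = 0" if "i < m" "j < m" "i \<noteq> j" for i j
  proof (cases "j < i")
    case True
    then show ?thesis using orthogonality[of i] assms that m_def by auto
  next
    case False
    then have "p j \<bullet> (Q *\<^sub>v p i) = 0" using orthogonality[of j] assms that m_def by auto
    then show ?thesis using Q_commute[of "p i" "p j"] by simp
  qed
  have sQs: "s i \<bullet> (Q *\<^sub>v s j) = (if i = j then 1 else 0)" if "i < m" "j < m" for i j
  proof -
    have "s i \<bullet> (Q *\<^sub>v s j) = (p i \<bullet> (Q *\<^sub>v p j)) / (sqrt (c i) * sqrt (c j))"
      by (simp add: s_def mult_mat_vec[OF Q_carrier])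
    then show ?thesis using that pQp[of i j] c[of i] by auto
  qed
  have "transpose_mat ?S * Q * ?S = 1\<^sub>m m"
  proof -
    have "transpose_mat ?S * Q * ?S = transpose_mat ?S * (Q * ?S)"
      using S by (intro assoc_mult_mat[of _ m n _ n _ m]) auto
    also have "\<dots> = 1\<^sub>m m"
      using S sQs by (intro eq_matI) (auto simp: col col_mult2[OF Q_carrier S])
    finally show ?thesis .
  qed
  with S Q show ?thesis unfolding conjugate_block_def m_def by simp
qed

lemma cols_pcg_S:
  assumes "u \<in> set (cols (pcg_S Q H g max_q))"
  obtains i a where "i < pcg_passes Q H g max_q" "u = a \<cdot>\<^sub>v p i"
proof -
  have "cols (pcg_S Q H g max_q)
      = map (\<lambda>i. (1 / sqrt (c i)) \<cdot>\<^sub>v p i) [0..<pcg_passes Q H g max_q]"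
    unfolding pcg_S_def Let_def by (subst cols_mat_of_cols) auto
  then show thesis using assms that by auto
qed

text \<open>The residual \<open>r\<^sub>i = g + Q y\<^sub>i\<close> is orthogonal to \<open>y\<^sub>i\<close>, which lies in the span of the
  directions.  Hence \<open>y\<^sub>i\<^sup>T g = - y\<^sub>i\<^sup>T Q y\<^sub>i \<le> 0\<close>, and the decrease of \<open>phi\<close> along the full step is
  one half of the predicted one; the line search asks only for the fraction \<open>10\<^sup>-\<^sup>4\<close>.\<close>

lemma unit_step_accepted:
  assumes pos: "\<And>j. j < i \<Longrightarrow> r j \<noteq> 0\<^sub>v n"
    and b: "b \<in> carrier_vec n" and x: "x \<in> carrier_vec n" and g_eq: "g = grad Q b x"
  shows "armijo Q b x (y i) 1"
proof -
  have Qy: "Q *\<^sub>v y i \<in> carrier_vec n" and Qx: "Q *\<^sub>v x \<in> carrier_vec n" using x by auto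
  have "r i \<bullet> y i = 0"
    using orthogonality[of i] pos by (intro orth_directions_imp_orth_y) auto
  then have stat: "y i \<bullet> g = - (y i \<bullet> (Q *\<^sub>v y i))"
    using comm_scalar_prod[OF y_carrier r_carrier, of i i]
    by (simp add: residual_eq scalar_prod_add_distrib[of _ n])
  have yg: "y i \<bullet> g = y i \<bullet> (Q *\<^sub>v x) - y i \<bullet> b"
  proof -
    have "y i \<bullet> grad Q b x = y i \<bullet> (Q *\<^sub>v x) - y i \<bullet> b"
      unfolding grad_def by (rule scalar_prod_minus_distrib[OF y_carrier Qx b])
    then show ?thesis by (simp only: g_eq[symmetric])
  qed
  have "phi Q b (x + 1 \<cdot>\<^sub>v y i) - phi Q b x = y i \<bullet> g + 1 / 2 * (y i \<bullet> (Q *\<^sub>v y i))"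
    unfolding phi_def yg using x b Qx Qy Q_commute[OF x y_carrier, of i]
    by (simp add: mult_add_distrib_mat_vec[OF Q_carrier] scalar_prod_add_distrib[of _ n]
        add_scalar_prod_distrib[of _ n] field_simps)
  also have "\<dots> = 1 / 2 * (y i \<bullet> g)" using stat by simp
  also have "\<dots> \<le> 1 / 10 ^ 4 * (y i \<bullet> g)"
    using stat spd_nonneg[OF Q y_carrier, of i] by simp
  finally show ?thesis unfolding armijo_def g_eq by simp
qed

lemma residual_orth_block:
  assumes pos: "\<And>i. i < pcg_passes Q H g max_q \<Longrightarrow> r i \<noteq> 0\<^sub>v n"
    and u: "u \<in> set (cols (pcg_S Q H g max_q))"
  shows "u \<bullet> r (pcg_passes Q H g max_q) = 0"
proof -
  let ?q = "pcg_passes Q H g max_q"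
  obtain i a where i: "i < ?q" "u = a \<cdot>\<^sub>v p i" using u by (rule cols_pcg_S)
  have "r ?q \<bullet> p i = 0" using orthogonality[of ?q] pos i(1) by blast
  then show ?thesis using i(2) by (simp add: comm_scalar_prod[of "p i" n])
qed

lemma block_conjugate_to_fixed:
  assumes u: "u \<in> carrier_vec n" and fixed: "H *\<^sub>v (Q *\<^sub>v u) = u" and orth: "u \<bullet> g = 0"
    and w: "w \<in> set (cols (pcg_S Q H g max_q))"
  shows "w \<bullet> (Q *\<^sub>v u) = 0"
proof -
  obtain i a where i: "w = a \<cdot>\<^sub>v p i" using w by (rule cols_pcg_S)
  have "p i \<bullet> (Q *\<^sub>v u) = 0"
    using direction_conjugate_to_fixed[OF u fixed orth] Q_commute[OF p_carrier u] by simp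
  then show ?thesis using u by (simp add: i)
qed

end

section \<open>Conjugacy across the major iterations\<close>

text \<open>The invariant carried from one major iteration to the next; \<open>U\<close> collects the columns of all
  blocks computed so far.  The facts about \<open>d\<close> are claimed only for nonempty \<open>U\<close>, because the
  initial direction does not come from an inner loop.  They say that the coming step has length
  \<open>1\<close> and that the gradient which it reaches is orthogonal to \<open>U\<close>.\<close>

definition hereditary ::
  "nat \<Rightarrow> real mat \<Rightarrow> real vec \<Rightarrow> real vec \<Rightarrow> real vec \<Rightarrow> real mat \<Rightarrow> real vec set \<Rightarrow> bool" where
  "hereditary n Q b x d H U \<longleftrightarrow>
     x \<in> carrier_vec n \<and> d \<in> carrier_vec n \<and> spd n H \<and> U \<subseteq> carrier_vec n \<and>
     (\<forall>u\<in>U. H *\<^sub>v (Q *\<^sub>v u) = u) \<and>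
     (U \<noteq> {} \<longrightarrow> armijo Q b x d 1 \<and> (\<forall>u\<in>U. u \<bullet> grad Q b (x + d) = 0))"

lemma grad_carrier:
  assumes "spd n Q" "b \<in> carrier_vec n" "x \<in> carrier_vec n"
  shows "grad Q b x \<in> carrier_vec n"
  using assms spd_carrier[OF assms(1)] unfolding grad_def by auto

lemma grad_add:
  assumes Q: "spd n Q" and b: "b \<in> carrier_vec n" and x: "x \<in> carrier_vec n" and d: "d \<in> carrier_vec n"
  shows "grad Q b (x + d) = grad Q b x + Q *\<^sub>v d"
proof -
  note Qc = spd_carrier[OF Q]
  have "Q *\<^sub>v x \<in> carrier_vec n" "Q *\<^sub>v d \<in> carrier_vec n" using Qc x d by auto
  then show ?thesis unfolding grad_def mult_add_distrib_mat_vec[OF Qc x d] using b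
    by (intro eq_vecI) (simp_all del: index_mult_mat_vec dim_mult_mat_vec)
qed

lemma hereditary_step:
  assumes Q: "spd n Q" and b: "b \<in> carrier_vec n" and "max_q \<ge> 1"
    and hered: "hereditary n Q b x d H U"
    and iter: "quNac_iteration Q b max_q \<epsilon> x0 x d H a S x' d' H'"
  shows "hereditary n Q b x' d' H' (U \<union> set (cols S)) \<and> (\<exists>m. S \<in> carrier_mat n m)"
proof -
  define g where "g = grad Q b x'"
  have x: "x \<in> carrier_vec n" and d: "d \<in> carrier_vec n" and H: "spd n H"
    and U: "\<And>u. u \<in> U \<Longrightarrow> u \<in> carrier_vec n" and fixed: "\<And>u. u \<in> U \<Longrightarrow> H *\<^sub>v (Q *\<^sub>v u) = u"
    using hered by (auto simp: hereditary_def)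
  have x'_eq: "x' = x + a \<cdot>\<^sub>v d" and S_eq: "S = pcg_S Q H g max_q"
    and d'_eq: "d' = pcg_y (pcg Q H g (pcg_passes Q H g max_q))"
    and H'_eq: "H' = quNac_update Q H S" and "grad Q b x' \<noteq> 0\<^sub>v (dim_vec x')"
    using iter by (auto simp: quNac_iteration_def g_def)
  moreover have x': "x' \<in> carrier_vec n" using x d by (simp add: x'_eq)
  ultimately have g0: "g \<noteq> 0\<^sub>v n" unfolding g_def by (metis carrier_vecD)
  have orth: "u \<bullet> g = 0" if "u \<in> U" for u
  proof -
    have "a = 1" using that hered iter by (auto simp: hereditary_def quNac_iteration_def)
    then show ?thesis using that hered by (auto simp: hereditary_def g_def x'_eq)
  qed
  interpret pcg_run n Q H g
    using Q H grad_carrier[OF Q b x'] by unfold_locales (simp_all add: g_def)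
  let ?q = "pcg_passes Q H g max_q"
  have pos: "r i \<noteq> 0\<^sub>v n" if "i < ?q" for i using residual_nonzero_before_exit[OF g0 \<open>max_q \<ge> 1\<close> that] .
  interpret block: conjugate_block n ?q Q S
    unfolding S_eq using pos by (rule pcg_S_conjugate_block)
  have grad': "grad Q b (x' + d') = r ?q"
    using grad_add[OF Q b x' y_carrier, of ?q] by (simp only: residual_eq d'_eq g_def[symmetric])
  have Sc: "u \<in> carrier_vec n" if "u \<in> set (cols S)" for u
    using that cols_dim[of S] block.S by auto
  have "H' *\<^sub>v (Q *\<^sub>v u) = u \<and> u \<bullet> r ?q = 0" if "u \<in> U \<union> set (cols S)" for u
    using that
  proof
    assume u: "u \<in> U"
    show ?thesis
      using block.update_secant_old[OF H_carrier U[OF u] fixed[OF u]]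
        block_conjugate_to_fixed[OF U[OF u] fixed[OF u] orth[OF u]]
        direction_conjugate_to_fixed[OF U[OF u] fixed[OF u] orth[OF u]]
      by (auto simp: H'_eq S_eq)
  next
    assume u: "u \<in> set (cols S)"
    show ?thesis
      using block.update_secant_new[OF H_carrier u] residual_orth_block[OF pos] u
      by (auto simp: H'_eq S_eq)
  qed
  moreover have "armijo Q b x' d' 1"
    unfolding d'_eq using pos b x' by (rule unit_step_accepted) (simp_all add: g_def)
  moreover have "spd n H'" unfolding H'_eq using H by (rule block.update_spd)
  ultimately have "hereditary n Q b x' d' H' (U \<union> set (cols S))"
    unfolding hereditary_def grad' using x' U Sc by (auto simp: d'_eq)
  then show ?thesis using block.S by blast
qed

lemma hereditary_run:
  assumes Q: "spd n Q" and b: "b \<in> carrier_vec n" and x0: "x0 \<in> carrier_vec n"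
    and H0: "spd n H0" and "max_q \<ge> 1"
    and run: "quNac_performed Q b max_q \<epsilon> x0 H0 x d H a S k" and "j \<le> Suc k"
  shows "hereditary n Q b (x j) (d j) (H j) (\<Union>i<j. set (cols (S i)))
    \<and> (\<forall>i<j. \<exists>m. S i \<in> carrier_mat n m)"
  using \<open>j \<le> Suc k\<close>
proof (induction j)
  case 0
  have "H0 *\<^sub>v grad Q b x0 \<in> carrier_vec n"
    using mult_mat_vec_carrier[OF spd_carrier[OF H0] grad_carrier[OF Q b x0]] .
  then show ?case using run x0 H0 by (simp add: hereditary_def quNac_performed_def)
next
  case (Suc j)
  then have "quNac_iteration Q b max_q \<epsilon> x0 (x j) (d j) (H j) (a j) (S j)
      (x (Suc j)) (d (Suc j)) (H (Suc j))"
    using run by (auto simp: quNac_performed_def)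
  then have "hereditary n Q b (x (Suc j)) (d (Suc j)) (H (Suc j))
      ((\<Union>i<j. set (cols (S i))) \<union> set (cols (S j))) \<and> (\<exists>m. S j \<in> carrier_mat n m)"
    using Suc by (intro hereditary_step[OF Q b \<open>max_q \<ge> 1\<close>]) auto
  then show ?case using Suc by (auto simp: lessThan_Suc Un_commute less_Suc_eq)
qed

theorem corollary5p1:
  fixes n max_q k :: nat and \<epsilon> :: real
    and Q H0 :: "real mat" and b x0 :: "real vec"
    and x d :: "nat \<Rightarrow> real vec" and H S :: "nat \<Rightarrow> real mat" and a :: "nat \<Rightarrow> real"
  assumes "spd n Q" and "b \<in> carrier_vec n"
    and "x0 \<in> carrier_vec n" and "spd n H0"
    and "max_q \<ge> 1" and "\<epsilon> > 0"
    and "k \<ge> 1" and "quNac_performed Q b max_q \<epsilon> x0 H0 x d H a S k"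
  shows "\<forall>i\<le>k. H (k + 1) * Q * S i = S i"
proof (intro allI impI)
  fix i assume "i \<le> k"
  have inv: "hereditary n Q b (x (Suc k)) (d (Suc k)) (H (Suc k)) (\<Union>i<Suc k. set (cols (S i)))"
    and "\<forall>i<Suc k. \<exists>m. S i \<in> carrier_mat n m"
    using hereditary_run[OF assms(1-5,8) order_refl] by auto
  then obtain m where S: "S i \<in> carrier_mat n m" using \<open>i \<le> k\<close> by (meson le_imp_less_Suc)
  have Q: "Q \<in> carrier_mat n n" and H: "H (Suc k) \<in> carrier_mat n n"
    using assms(1) inv by (auto simp: hereditary_def spd_carrier)
  have "col (H (Suc k) * Q * S i) j = col (S i) j" if "j < m" for j
  proof -
    have u: "col (S i) j \<in> carrier_vec n" "col (S i) j \<in> set (cols (S i))"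
      using S that by (auto simp: cols_def)
    have "H (Suc k) *\<^sub>v (Q *\<^sub>v col (S i) j) = col (S i) j"
      using inv u(2) \<open>i \<le> k\<close> unfolding hereditary_def by (meson UN_I le_imp_less_Suc lessThan_iff)
    then show ?thesis
      using col_mult2[OF mult_carrier_mat[OF H Q] S that] assoc_mult_mat_vec[OF H Q u(1)] by simp
  qed
  then show "H (k + 1) * Q * S i = S i"
    using S H by (intro mat_col_eqI) auto
qed

end
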